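(* Let a sequence of sparse vectors $\{\mathbf{x}^{(M)}\in\mathbb{C}^M\}_M$ with $\|\mathbf{x}^{(M)}\|_0=L=o(M)$ be given. Then asymptotic reliable recovery is not possible for $\{\mathbf{x}^{(M)}\}$ with respect to Error Metric 1 if $N\prec C'_2\,\frac{L\log(M-L)}{\log P}$, for some constant $C'_2>0$ that depends only on $P$ and $\nu$.
   Context: Model: $\mathbf{x}=\mathbf{x}^{(M)}\in\mathbb{C}^M$ is an unknown vector with support $\mathcal{I}=\{i: x_i\ne0\}$, $\|\mathbf{x}\|_0=|\mathcal{I}|=L$, and total power $P=\|\mathbf{x}\|_2^2$. One observes $\mathbf{y}=\mathbf{A}\mathbf{x}+\mathbf{n}\in\mathbb{C}^N$, where $N$ is a function of $M$, $\mathbf{A}$ is an $N\times M$ Gaussian measurement matrix (i.i.d. circularly symmetric complex Gaussian entries $a_{i,j}\sim\mathcal{N}_C(0,1)$), and $\mathbf{n}\sim\mathcal{N}_C(0,\nu^2I_N)$ is circularly symmetric complex Gaussian noise independent of $\mathbf{A}$. Decoder: a sparse recovery algorithm, knowing $\mathbf{A}$ and observing $\mathbf{y}$, outputs an estimate $\hat{\mathbf{x}}$ with $\|\hat{\mathbf{x}}\|_0=L$; a decoder $\mathcal{D}$ outputs the corresponding set of indices $\mathcal{D}(\mathbf{y})=\{i:\hat x_i\ne0\}$. Error Metric 1 ($0$-$1$ loss): recovery is successful iff $\hat x_i\ne0$ for all $i\in\mathcal{I}$ and $\hat x_j=0$ for all $j\notin\mathcal{I}$, i.e. iff $\mathcal{D}(\mathbf{y})=\mathcal{I}$.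 For fixed $\mathbf{A}$, $p_{\rm err}(\mathbf{A}|\mathbf{x}^{(M)})=\mathbb{P}(\mathcal{D}(\mathbf{y})\ne\mathcal{I})$, and $p_{\rm err}(\mathcal{D}|\mathbf{x}^{(M)})=\mathbb{E}_{\mathbf{A}}\big(p_{\rm err}(\mathbf{A}|\mathbf{x}^{(M)})\big)$. Asymptotic reliable recovery is not possible if, for any decoder, $p_{\rm err}(\mathcal{D}|\mathbf{x}^{(M)})$ stays bounded away from $0$ as $M\to\infty$. Notation: $f\succ g$ means that either $f=g=0$, or $f,g$ are non-decreasing non-negative functions and there is $x_0$ such that $f(x)/g(x)>1$ for all $x>x_0$ (here as functions of $M$); $f\prec g$ means $g\succ f$.
   Formalization: As a decoder always answering supp(x^(M)) has error 0, the error is bounded away from 0 for some coordinate permutation of x^(M), chosen per decoder and M. P>0 is assumed for large M (so log P makes sense); if P varies with M, C'_2 is taken at the current P. *)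

theory Defs
  imports "HOL-Probability.Probability" "HOL-Library.Landau_Symbols"
    "HOL-Combinatorics.Permutations"
begin

text \<open>
  The dimensions \<open>M\<close> and \<open>N\<close> vary along the sequence, so a vector in \<open>\<complex>\<^sup>M\<close> is a function
  \<open>nat \<Rightarrow> complex\<close> of which only the values on \<open>{..<M}\<close> matter, and an \<open>N \<times> M\<close> matrix is a
  function on \<open>{..<N} \<times> {..<M}\<close>.
\<close>

definition supp :: "nat \<Rightarrow> (nat \<Rightarrow> complex) \<Rightarrow> nat set" where
  "supp M x = {i. i < M \<and> x i \<noteq> 0}"

definition l0norm :: "nat \<Rightarrow> (nat \<Rightarrow> complex) \<Rightarrow> nat" where
  "l0norm M x = card (supp M x)"

definition total_power :: "nat \<Rightarrow> (nat \<Rightarrow> complex) \<Rightarrow> real" where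
  "total_power M x = (\<Sum>i<M. (cmod (x i))\<^sup>2)"


text \<open>
  The circularly symmetric law \<open>N\<^sub>C(0, v)\<close>: independent real and imaginary parts, each of
  variance \<open>v / 2\<close> (the second argument of \<open>normal_density\<close> is the standard deviation).
\<close>

definition complex_normal :: "real \<Rightarrow> complex measure" where
  "complex_normal v =
     (let G = density lborel (\<lambda>t. ennreal (normal_density 0 (sqrt (v / 2)) t))
      in distr (G \<Otimes>\<^sub>M G) borel (\<lambda>(a, b). Complex a b))"

definition gauss_matrix :: "nat \<Rightarrow> nat \<Rightarrow> (nat \<times> nat \<Rightarrow> complex) measure" where
  "gauss_matrix N M = (\<Pi>\<^sub>M p\<in>{..<N} \<times> {..<M}. complex_normal 1)"

definition gauss_noise :: "real \<Rightarrow> nat \<Rightarrow> (nat \<Rightarrow> complex) measure" where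
  "gauss_noise \<nu> N = (\<Pi>\<^sub>M i\<in>{..<N}. complex_normal (\<nu>\<^sup>2))"

definition observation ::
  "nat \<Rightarrow> nat \<Rightarrow> (nat \<times> nat \<Rightarrow> complex) \<Rightarrow> (nat \<Rightarrow> complex) \<Rightarrow> (nat \<Rightarrow> complex) \<Rightarrow> nat \<Rightarrow> complex"
where
  "observation N M A x n = (\<lambda>i\<in>{..<N}. (\<Sum>j<M. A (i, j) * x j) + n i)"


text \<open>
  A recovery algorithm maps \<open>A\<close> and \<open>y\<close> to an estimate with exactly \<open>L\<close> nonzero entries;
  measurability makes its error probabilities meaningful.
\<close>

definition recovery_algorithm ::
  "nat \<Rightarrow> nat \<Rightarrow> nat \<Rightarrow> ((nat \<times> nat \<Rightarrow> complex) \<Rightarrow> (nat \<Rightarrow> complex) \<Rightarrow> nat \<Rightarrow> complex) \<Rightarrow> bool"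
where
  "recovery_algorithm N M L R \<longleftrightarrow>
     (\<lambda>(A, y). R A y) \<in> (\<Pi>\<^sub>M p\<in>{..<N} \<times> {..<M}. borel) \<Otimes>\<^sub>M (\<Pi>\<^sub>M i\<in>{..<N}. borel)
                       \<rightarrow>\<^sub>M (\<Pi>\<^sub>M j\<in>{..<M}. borel) \<and>
     (\<forall>A \<in> ({..<N} \<times> {..<M}) \<rightarrow>\<^sub>E UNIV. \<forall>y \<in> {..<N} \<rightarrow>\<^sub>E UNIV. l0norm M (R A y) = L)"

definition decoder ::
  "nat \<Rightarrow> ((nat \<times> nat \<Rightarrow> complex) \<Rightarrow> (nat \<Rightarrow> complex) \<Rightarrow> nat \<Rightarrow> complex)
     \<Rightarrow> (nat \<times> nat \<Rightarrow> complex) \<Rightarrow> (nat \<Rightarrow> complex) \<Rightarrow> nat set" where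
  "decoder M R A y = supp M (R A y)"

definition p_err_given ::
  "real \<Rightarrow> nat \<Rightarrow> nat \<Rightarrow> ((nat \<times> nat \<Rightarrow> complex) \<Rightarrow> (nat \<Rightarrow> complex) \<Rightarrow> nat set)
     \<Rightarrow> (nat \<Rightarrow> complex) \<Rightarrow> (nat \<times> nat \<Rightarrow> complex) \<Rightarrow> real" where
  "p_err_given \<nu> N M D x A =
     measure (gauss_noise \<nu> N)
       {n \<in> space (gauss_noise \<nu> N). D A (observation N M A x n) \<noteq> supp M x}"

definition p_err ::
  "real \<Rightarrow> nat \<Rightarrow> nat \<Rightarrow> ((nat \<times> nat \<Rightarrow> complex) \<Rightarrow> (nat \<Rightarrow> complex) \<Rightarrow> nat set)
     \<Rightarrow> (nat \<Rightarrow> complex) \<Rightarrow> real" where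
  "p_err \<nu> N M D x = (\<integral>A. p_err_given \<nu> N M D x A \<partial>gauss_matrix N M)"


text \<open>
  Decoders do not know the vector \<open>x\<close>.  As functions, though, they also include the constant one
  that always returns the support of the given \<open>x M\<close>, whose error probability is \<open>0\<close>.  That the
  support is unknown is therefore expressed by not telling the decoder how the coordinates of
  \<open>x M\<close> are labelled: the error must stay bounded away from \<open>0\<close> under some relabelling
  \<open>x M \<circ> \<sigma>\<close>, where \<open>\<sigma>\<close> permutes the coordinates.  No further restriction is put on decoders,
  which may depend on \<open>x M\<close> in any other way.  For a decoder that treats all coordinates alike
  the relabelling is immaterial, see \<open>p_err_relabel\<close> below.
\<close>

definition recovery_not_possible ::
  "real \<Rightarrow> (nat \<Rightarrow> nat) \<Rightarrow> (nat \<Rightarrow> nat \<Rightarrow> complex) \<Rightarrow> bool" where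
  "recovery_not_possible \<nu> N x \<longleftrightarrow>
     (\<forall>R. (\<forall>M. recovery_algorithm (N M) M (l0norm M (x M)) (R M)) \<longrightarrow>
        (\<exists>\<epsilon>>0. \<forall>\<^sub>F M in sequentially.
           \<exists>\<sigma>. \<sigma> permutes {..<M} \<and> \<epsilon> \<le> p_err \<nu> (N M) M (decoder M (R M)) (x M \<circ> \<sigma>)))"


text \<open>
  \<open>eventually_dominates f g\<close> is \<open>f \<succ> g\<close>.  The quotient is taken in \<open>ereal\<close> so that \<open>a / 0\<close> is
  \<open>\<infinity>\<close> for \<open>a > 0\<close>.
\<close>

definition eventually_dominates :: "(nat \<Rightarrow> real) \<Rightarrow> (nat \<Rightarrow> real) \<Rightarrow> bool" where
  "eventually_dominates f g \<longleftrightarrow>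
     ((\<forall>m. f m = 0) \<and> (\<forall>m. g m = 0)) \<or>
     (mono f \<and> mono g \<and> (\<forall>m. 0 \<le> f m) \<and> (\<forall>m. 0 \<le> g m) \<and>
      (\<exists>m\<^sub>0. \<forall>m>m\<^sub>0. ereal (f m) / ereal (g m) > 1))"


lemma sets_complex_normal [simp, measurable_cong]: "sets (complex_normal v) = sets borel"
  by (simp add: complex_normal_def Let_def)

lemma space_complex_normal [simp]: "space (complex_normal v) = UNIV"
  by (simp add: complex_normal_def Let_def)

lemma measurable_Complex [measurable]: "(\<lambda>(a, b). Complex a b) \<in> borel \<Otimes>\<^sub>M borel \<rightarrow>\<^sub>M borel"
proof -
  have "(\<lambda>p. complex_of_real (fst p) + \<i> * complex_of_real (snd p))
          \<in> borel \<Otimes>\<^sub>M borel \<rightarrow>\<^sub>M borel"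
    by measurable
  then show ?thesis
    by (simp add: Complex_eq case_prod_beta)
qed

lemma prob_space_complex_normal:
  assumes "0 < v"
  shows "prob_space (complex_normal v)"
proof -
  define G where "G = density lborel (\<lambda>t. ennreal (normal_density 0 (sqrt (v / 2)) t))"
  have "prob_space G"
    unfolding G_def using assms by (intro prob_space_normal_density) simp
  then interpret G: prob_space G .
  interpret GG: pair_prob_space G G ..
  have [measurable_cong]: "sets G = sets borel"
    by (simp add: G_def)
  have "prob_space (distr (G \<Otimes>\<^sub>M G) borel (\<lambda>(a, b). Complex a b))"
    by (rule GG.prob_space_distr) measurable
  then show ?thesis
    by (simp add: complex_normal_def G_def Let_def)
qed

lemma ereal_quotient_gt_1_iff:
  assumes "0 \<le> a" "0 \<le> b"
  shows "ereal a / ereal b > 1 \<longleftrightarrow> a > b"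
  using assms by (cases "b = 0") (auto simp: zero_less_divide_iff less_le)


text \<open>
  \<open>relabel N M \<sigma> A\<close> permutes the columns of \<open>A\<close>; a decoder treats all coordinates alike if this
  permutes its output accordingly.
\<close>

definition relabel ::
  "nat \<Rightarrow> nat \<Rightarrow> (nat \<Rightarrow> nat) \<Rightarrow> (nat \<times> nat \<Rightarrow> complex) \<Rightarrow> nat \<times> nat \<Rightarrow> complex" where
  "relabel N M \<sigma> A = (\<lambda>p\<in>{..<N} \<times> {..<M}. A (fst p, \<sigma> (snd p)))"

lemma p_err_relabel:
  assumes R: "recovery_algorithm N M L R" and nu: "0 < \<nu>" and s: "\<sigma> permutes {..<M}"
    and equivariant: "\<And>\<tau> A y. \<tau> permutes {..<M} \<Longrightarrow> A \<in> ({..<N} \<times> {..<M}) \<rightarrow>\<^sub>E UNIV \<Longrightarrow>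
      y \<in> {..<N} \<rightarrow>\<^sub>E UNIV \<Longrightarrow> decoder M R (relabel N M \<tau> A) y = \<tau> -` decoder M R A y"
  shows "p_err \<nu> N M (decoder M R) (x \<circ> \<sigma>) = p_err \<nu> N M (decoder M R) x"
proof -
  let ?I = "{..<N} \<times> {..<M}" and ?D = "decoder M R"
  interpret C: prob_space "complex_normal (\<nu>\<^sup>2)"
    using nu by (intro prob_space_complex_normal) simp
  interpret C1: prob_space "complex_normal 1"
    by (intro prob_space_complex_normal) simp
  interpret PN: product_prob_space "\<lambda>_::nat. complex_normal (\<nu>\<^sup>2)" "{..<N}" ..
  interpret PA: product_prob_space "\<lambda>_::nat\<times>nat. complex_normal 1" "?I" ..
  interpret Noise: prob_space "gauss_noise \<nu> N"
    unfolding gauss_noise_def by (rule PN.P.prob_space_axioms)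
  define t where "t = inv \<sigma>"
  have t: "t permutes {..<M}"
    using s by (simp add: t_def permutes_inv)
  have st: "\<sigma> (t j) = j" and ts: "t (\<sigma> j) = j" for j
    using permutes_inverses[OF s] by (auto simp: t_def)
  have sp: "space (gauss_matrix N M) = ?I \<rightarrow>\<^sub>E UNIV" "space (gauss_noise \<nu> N) = {..<N} \<rightarrow>\<^sub>E UNIV"
    by (auto simp: gauss_matrix_def gauss_noise_def space_PiM)
  have sets_A [measurable_cong]: "sets (gauss_matrix N M) = sets (\<Pi>\<^sub>M p\<in>?I. borel)"
    unfolding gauss_matrix_def by (intro sets_PiM_cong) auto
  have sets_N [measurable_cong]: "sets (gauss_noise \<nu> N) = sets (\<Pi>\<^sub>M i\<in>{..<N}. borel)"
    unfolding gauss_noise_def by (intro sets_PiM_cong) auto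
  have obs: "observation N M A (x \<circ> \<sigma>) n = observation N M (relabel N M t A) x n" for A n
  proof -
    have "(\<Sum>j<M. A (i, j) * x (\<sigma> j)) = (\<Sum>j<M. A (i, t j) * x j)" for i
      using sum.permute[OF t, of "\<lambda>j. A (i, j) * x (\<sigma> j)"] by (simp add: o_def st)
    then show ?thesis
      unfolding observation_def relabel_def by (intro restrict_ext) simp
  qed
  have given: "p_err_given \<nu> N M ?D (x \<circ> \<sigma>) A = p_err_given \<nu> N M ?D x (relabel N M t A)"
    if A: "A \<in> space (gauss_matrix N M)" for A
  proof -
    define B where "B = relabel N M t A"
    have B: "B \<in> ?I \<rightarrow>\<^sub>E UNIV"
      by (auto simp: B_def relabel_def)
    have AB: "A = relabel N M \<sigma> B"
    proof
      fix p show "A p = relabel N M \<sigma> B p"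
        using A permutes_in_image[OF s, of "snd p"]
        by (cases p) (auto simp: sp B_def relabel_def ts PiE_def extensional_def)
    qed
    have "?D A y \<noteq> supp M (x \<circ> \<sigma>) \<longleftrightarrow> ?D B y \<noteq> supp M x" if "y \<in> {..<N} \<rightarrow>\<^sub>E UNIV" for y
    proof -
      have "?D A y = \<sigma> -` ?D B y"
        using equivariant[OF s B that] AB by simp
      moreover have "supp M (x \<circ> \<sigma>) = \<sigma> -` supp M x"
        using permutes_in_image[OF s] by (auto simp: supp_def)
      ultimately show ?thesis
        using permutes_surj[OF s] by (metis surj_image_vimage_eq)
    qed
    moreover have "observation N M B x n \<in> {..<N} \<rightarrow>\<^sub>E UNIV" for n
      by (auto simp: observation_def)
    ultimately show ?thesis
      unfolding p_err_given_def obs B_def[symmetric] by simp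
  qed
  have R_meas [measurable]: "(\<lambda>(A, y). R A y) \<in>
      (\<Pi>\<^sub>M p\<in>?I. borel) \<Otimes>\<^sub>M (\<Pi>\<^sub>M i\<in>{..<N}. borel) \<rightarrow>\<^sub>M (\<Pi>\<^sub>M j\<in>{..<M}. borel)"
    using R by (simp add: recovery_algorithm_def)
  have obs_meas: "(\<lambda>p. observation N M (fst p) x (snd p)) \<in>
      gauss_matrix N M \<Otimes>\<^sub>M gauss_noise \<nu> N \<rightarrow>\<^sub>M (\<Pi>\<^sub>M i\<in>{..<N}. borel)"
    unfolding observation_def by measurable
  have est: "(\<lambda>p. R (fst p) (observation N M (fst p) x (snd p))) \<in>
      gauss_matrix N M \<Otimes>\<^sub>M gauss_noise \<nu> N \<rightarrow>\<^sub>M (\<Pi>\<^sub>M j\<in>{..<M}. borel)"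
    using measurable_compose[OF measurable_Pair[OF _ obs_meas] R_meas, of fst]
    by (simp add: measurable_fst cong: measurable_cong_sets)
  let ?E = "{p \<in> space (gauss_matrix N M \<Otimes>\<^sub>M gauss_noise \<nu> N).
      ?D (fst p) (observation N M (fst p) x (snd p)) \<noteq> supp M x}"
  have E: "?E \<in> sets (gauss_matrix N M \<Otimes>\<^sub>M gauss_noise \<nu> N)"
  proof -
    have "?E = {p \<in> space (gauss_matrix N M \<Otimes>\<^sub>M gauss_noise \<nu> N). \<exists>j\<in>{..<M}.
        (R (fst p) (observation N M (fst p) x (snd p)) j \<noteq> 0) \<noteq> (x j \<noteq> 0)}"
      by (auto simp: decoder_def supp_def)
    also have "\<dots> \<in> sets (gauss_matrix N M \<Otimes>\<^sub>M gauss_noise \<nu> N)"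
      using measurable_compose[OF est measurable_component_singleton] by measurable
    finally show ?thesis .
  qed
  have meas: "p_err_given \<nu> N M ?D x \<in> borel_measurable (gauss_matrix N M)"
  proof -
    have "(\<lambda>A. measure (gauss_noise \<nu> N) (Pair A -` ?E)) \<in> borel_measurable (gauss_matrix N M)"
      unfolding measure_def using Noise.measurable_emeasure_Pair[OF E] by measurable
    moreover have "measure (gauss_noise \<nu> N) (Pair A -` ?E) = p_err_given \<nu> N M ?D x A"
      if "A \<in> space (gauss_matrix N M)" for A
      unfolding p_err_given_def using that
      by (intro arg_cong[where f = "measure _"]) (auto simp: space_pair_measure)
    ultimately show ?thesis
      by (simp cong: measurable_cong)
  qed
  have "distr (gauss_matrix N M) (gauss_matrix N M) (relabel N M t) = gauss_matrix N M"
  proof -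
    have "inj_on (\<lambda>p. (fst p, t (snd p))) ?I"
      by (auto simp: inj_on_def inj_eq[OF permutes_inj[OF t]])
    moreover have "(\<lambda>p. (fst p, t (snd p))) \<in> ?I \<rightarrow> ?I"
    proof
      fix p assume "p \<in> ?I"
      then show "(fst p, t (snd p)) \<in> ?I"
        using permutes_in_image[OF t, of "snd p"] by (simp add: mem_Times_iff)
    qed
    ultimately have "distr (Pi\<^sub>M ?I (\<lambda>_. complex_normal 1)) (Pi\<^sub>M ?I (\<lambda>_. complex_normal 1))
        (\<lambda>A. \<lambda>p\<in>?I. A (fst p, t (snd p))) = Pi\<^sub>M ?I (\<lambda>_. complex_normal 1)"
      by (rule distr_PiM_reindex[of ?I "\<lambda>_. complex_normal 1" "\<lambda>p. (fst p, t (snd p))" ?I,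
            OF C1.prob_space_axioms])
    then show ?thesis
      unfolding gauss_matrix_def relabel_def .
  qed
  moreover have "relabel N M t \<in> gauss_matrix N M \<rightarrow>\<^sub>M gauss_matrix N M"
    unfolding gauss_matrix_def relabel_def[abs_def]
    by (intro measurable_restrict measurable_component_singleton)
      (simp add: mem_Times_iff permutes_in_image[OF t, unfolded lessThan_iff])
  ultimately have "(\<integral>A. p_err_given \<nu> N M ?D x (relabel N M t A) \<partial>gauss_matrix N M)
      = (\<integral>A. p_err_given \<nu> N M ?D x A \<partial>gauss_matrix N M)"
    using integral_distr[OF _ meas] by metis
  then show ?thesis
    unfolding p_err_def by (simp add: given cong: Bochner_Integration.integral_cong)
qed

end

theory Submission
  imports Defs
begin

text \<open>
  Let \<open>v\<close> be a nonzero entry of \<open>x\<close> of least modulus, so \<open>\<bar>v\<bar>\<^sup>2 \<le> P / L\<close>.  Reveal all other entries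
  to the decoder: there remain \<open>K = M - L + 1\<close> candidates for the position \<open>k\<close> of \<open>v\<close>, all
  relabellings of \<open>x\<close>.  Given \<open>A\<close>, the observation for candidate \<open>k\<close> is the shift by \<open>v a\<^sub>k\<close> of a
  vector with Gaussian law \<open>Q\<close> that does not depend on \<open>k\<close>.  By the Cauchy--Schwarz inequality its
  probability of an event \<open>E\<^sub>k\<close> is at most \<open>(exp (2 W\<^sub>k) Q(E\<^sub>k))\<^sup>1\<^sup>/\<^sup>2\<close>, where
  \<open>W\<^sub>k = \<bar>v a\<^sub>k\<bar>\<^sup>2 / \<nu>\<^sup>2\<close> has mean \<open>N \<bar>v\<bar>\<^sup>2 / \<nu>\<^sup>2\<close>.  The events that the decoder answers \<open>k\<close> are disjoint,
  so \<open>Q(E\<^sub>k)\<close> is at most \<open>1 / K\<close> on average, and the average success probability stays below \<open>1\<close> as long as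
  the mean of \<open>W\<^sub>k\<close> is a small multiple of \<open>ln K\<close>, hence if \<open>N P / (L \<nu>\<^sup>2)\<close> is.
\<close>

section \<open>Second-moment bounds for shifted Gaussian laws\<close>

text \<open>Cauchy-Schwarz after a change of measure: the shift is absorbed into a likelihood ratio
  \<open>r\<close> against the unshifted law, and the exponential factor is the second moment of
  \<open>r\<close>.\<close>

lemma nn_integral_normal_shift_power2_le:
  fixes g :: "real \<Rightarrow> ennreal"
  assumes "0 < \<sigma>" and [measurable]: "g \<in> borel_measurable borel"
  defines "G \<equiv> density lborel (\<lambda>t. ennreal (normal_density 0 \<sigma> t))"
  shows "(\<integral>\<^sup>+t. g (t + a) \<partial>G)\<^sup>2 \<le> ennreal (exp (a\<^sup>2 / \<sigma>\<^sup>2)) * (\<integral>\<^sup>+t. (g t)\<^sup>2 \<partial>G)"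
proof -
  define r where "r t = exp ((2 * t * a - a\<^sup>2) / (2 * \<sigma>\<^sup>2))" for t
  have r_nonneg: "0 \<le> r t" for t
    by (simp add: r_def)
  have [measurable]: "r \<in> borel_measurable borel"
    unfolding r_def by measurable
  have [measurable_cong]: "sets G = sets borel"
    by (simp add: G_def)
  have shift: "normal_density 0 \<sigma> (t - a) = normal_density 0 \<sigma> t * r t" for t
    using assms(1) by (simp add: normal_density_def r_def exp_add[symmetric] field_simps power2_eq_square)
  \<comment> \<open>Completing the square: weighting by the squared ratio recentres the density at
    \<open>2 * a\<close>. It still has mass 1, so only the exponential constant survives
    integration.\<close>
  have square: "normal_density 0 \<sigma> t * (r t)\<^sup>2 = exp (a\<^sup>2 / \<sigma>\<^sup>2) * normal_density (2 * a) \<sigma> t" for t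
    using assms(1)
    by (simp add: normal_density_def r_def exp_add[symmetric] exp_double[symmetric] field_simps power2_eq_square)
  have "(\<integral>\<^sup>+t. g (t + a) \<partial>G) = (\<integral>\<^sup>+t. ennreal (normal_density 0 \<sigma> t) * g (t + a) \<partial>lborel)"
    unfolding G_def by (subst nn_integral_density) auto
  \<comment> \<open>Translation invariance of Lebesgue measure moves the shift from \<open>g\<close>
    to the density.\<close>
  also have "\<dots> = (\<integral>\<^sup>+t. ennreal (normal_density 0 \<sigma> (t - a)) * g t \<partial>lborel)"
    by (subst (2) nn_integral_real_affine[where c = 1 and t = a]) (auto simp: add_ac)
  also have "\<dots> = (\<integral>\<^sup>+t. ennreal (r t) * g t \<partial>G)"
    unfolding G_def
    by (subst nn_integral_density) (auto simp: shift ennreal_mult r_nonneg mult_ac simp del: ennreal_mult' intro!: nn_integral_cong)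
  finally have "(\<integral>\<^sup>+t. g (t + a) \<partial>G)\<^sup>2 \<le> (\<integral>\<^sup>+t. (ennreal (r t))\<^sup>2 \<partial>G) * (\<integral>\<^sup>+t. (g t)\<^sup>2 \<partial>G)"
    using Cauchy_Schwarz_nn_integral[of "\<lambda>t. ennreal (r t)" G g] by simp
  also have "(\<integral>\<^sup>+t. (ennreal (r t))\<^sup>2 \<partial>G)
      = (\<integral>\<^sup>+t. ennreal (exp (a\<^sup>2 / \<sigma>\<^sup>2)) * ennreal (normal_density (2 * a) \<sigma> t) \<partial>lborel)"
    unfolding G_def
    by (subst nn_integral_density)
      (auto simp: ennreal_power r_def ennreal_mult[symmetric] square[unfolded r_def] simp del: ennreal_mult')
  also have "\<dots> = ennreal (exp (a\<^sup>2 / \<sigma>\<^sup>2))"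
    using prob_space.emeasure_space_1[OF prob_space_normal_density[OF assms(1), of "2 * a"]]
    by (simp add: nn_integral_cmult emeasure_density)
  finally show ?thesis .
qed

lemma nn_integral_complex_normal:
  assumes "0 < v" and [measurable]: "g \<in> borel_measurable borel"
  defines "G \<equiv> density lborel (\<lambda>t. ennreal (normal_density 0 (sqrt (v / 2)) t))"
  shows "(\<integral>\<^sup>+z. g z \<partial>complex_normal v) = (\<integral>\<^sup>+a. \<integral>\<^sup>+b. g (Complex a b) \<partial>G \<partial>G)"
proof -
  have "prob_space G"
    unfolding G_def using assms(1) by (intro prob_space_normal_density) simp
  then interpret G: prob_space G .
  have [measurable_cong]: "sets G = sets borel"
    by (simp add: G_def)
  have "(\<integral>\<^sup>+z. g z \<partial>complex_normal v) = (\<integral>\<^sup>+p. g (case p of (a, b) \<Rightarrow> Complex a b) \<partial>(G \<Otimes>\<^sub>M G))"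
    unfolding complex_normal_def Let_def G_def[symmetric]
    by (subst nn_integral_distr) auto
  also have "\<dots> = (\<integral>\<^sup>+a. \<integral>\<^sup>+b. g (Complex a b) \<partial>G \<partial>G)"
    by (subst G.nn_integral_fst[symmetric]) auto
  finally show ?thesis .
qed

text \<open>The real and imaginary parts are independent with variance \<open>v / 2\<close> each, so
  the one-dimensional bound is applied to one after the other and the two exponents add up.\<close>

lemma nn_integral_complex_normal_shift_power2_le:
  fixes g :: "complex \<Rightarrow> ennreal"
  assumes v: "0 < v" and [measurable]: "g \<in> borel_measurable borel"
  shows "(\<integral>\<^sup>+z. g (z + s) \<partial>complex_normal v)\<^sup>2
    \<le> ennreal (exp (2 * (cmod s)\<^sup>2 / v)) * (\<integral>\<^sup>+z. (g z)\<^sup>2 \<partial>complex_normal v)"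
proof -
  define G where "G = density lborel (\<lambda>t. ennreal (normal_density 0 (sqrt (v / 2)) t))"
  have "prob_space G"
    unfolding G_def using v by (intro prob_space_normal_density) simp
  then interpret G: prob_space G .
  have [measurable_cong]: "sets G = sets borel"
    by (simp add: G_def)
  have [measurable]: "(\<lambda>p. Complex (fst p) (snd p)) \<in> borel \<Otimes>\<^sub>M borel \<rightarrow>\<^sub>M borel"
    using measurable_Complex by (simp add: case_prod_beta')
  have gm [measurable]: "(\<lambda>p. g (Complex (fst p) (snd p + Im s))) \<in> borel_measurable (borel \<Otimes>\<^sub>M G)"
  proof -
    have "(\<lambda>p. (fst p, snd p + Im s)) \<in> borel \<Otimes>\<^sub>M G \<rightarrow>\<^sub>M borel \<Otimes>\<^sub>M borel"
      by measurable
    from measurable_compose[OF this, of "\<lambda>p. g (Complex (fst p) (snd p))" borel]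
    show ?thesis by simp
  qed
  \<comment> \<open>The imaginary shift is integrated inside \<open>h\<close>; the real shift
    remains as a shift of the argument of \<open>h\<close>.\<close>
  define h where "h a = (\<integral>\<^sup>+b. g (Complex a (b + Im s)) \<partial>G)" for a
  have [measurable]: "h \<in> borel_measurable borel"
    unfolding h_def using G.borel_measurable_nn_integral_fst[OF gm] by simp
  have gC [measurable]: "(\<lambda>b. g (Complex a b)) \<in> borel_measurable borel" for a
    by (rule measurable_compose[OF _ assms(2)]) (simp add: Complex_eq)
  have "(\<integral>\<^sup>+z. g (z + s) \<partial>complex_normal v) = (\<integral>\<^sup>+a. h (a + Re s) \<partial>G)"
    using v by (subst nn_integral_complex_normal) (auto simp: G_def[symmetric] h_def plus_complex.code)
  then have "(\<integral>\<^sup>+z. g (z + s) \<partial>complex_normal v)\<^sup>2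
      \<le> ennreal (exp ((Re s)\<^sup>2 / (v / 2))) * (\<integral>\<^sup>+a. (h a)\<^sup>2 \<partial>G)"
    using nn_integral_normal_shift_power2_le[of "sqrt (v / 2)" h "Re s"] v by (simp add: G_def)
  \<comment> \<open>The first application leaves \<open>h\<close> squared, which is again the square
    of a shifted integral, so the bound applies for each fixed real part.\<close>
  also have "(\<integral>\<^sup>+a. (h a)\<^sup>2 \<partial>G)
      \<le> (\<integral>\<^sup>+a. ennreal (exp ((Im s)\<^sup>2 / (v / 2))) * (\<integral>\<^sup>+b. (g (Complex a b))\<^sup>2 \<partial>G) \<partial>G)"
    using nn_integral_normal_shift_power2_le[of "sqrt (v / 2)" "\<lambda>b. g (Complex _ b)" "Im s"] v
    by (intro nn_integral_mono) (simp add: G_def h_def)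
  also have "\<dots> = ennreal (exp ((Im s)\<^sup>2 / (v / 2))) * (\<integral>\<^sup>+z. (g z)\<^sup>2 \<partial>complex_normal v)"
  proof -
    have "(\<lambda>a. \<integral>\<^sup>+b. (g (Complex a b))\<^sup>2 \<partial>G) \<in> borel_measurable G"
      by measurable
    moreover have "(\<integral>\<^sup>+z. (g z)\<^sup>2 \<partial>complex_normal v) = (\<integral>\<^sup>+a. \<integral>\<^sup>+b. (g (Complex a b))\<^sup>2 \<partial>G \<partial>G)"
      unfolding G_def by (rule nn_integral_complex_normal[OF v]) measurable
    ultimately show ?thesis
      by (simp only: nn_integral_cmult)
  qed
  also have "ennreal (exp ((Re s)\<^sup>2 / (v / 2))) * \<dots>
      = ennreal (exp (2 * (cmod s)\<^sup>2 / v)) * (\<integral>\<^sup>+z. (g z)\<^sup>2 \<partial>complex_normal v)"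
  proof -
    have "(Re s)\<^sup>2 / (v / 2) + (Im s)\<^sup>2 / (v / 2) = 2 * (cmod s)\<^sup>2 / v"
      by (simp add: cmod_power2 distrib_left add_divide_distrib mult.commute)
    then have "ennreal (exp ((Re s)\<^sup>2 / (v / 2))) * ennreal (exp ((Im s)\<^sup>2 / (v / 2)))
        = ennreal (exp (2 * (cmod s)\<^sup>2 / v))"
      by (simp only: ennreal_mult'[OF exp_ge_zero, symmetric] exp_add[symmetric])
    then show ?thesis
      by (simp only: mult.assoc[symmetric])
  qed
  finally show ?thesis
    by (simp add: mult_left_mono)
qed

text \<open>Gives the mean energy of a matrix entry; the real and imaginary parts contribute
  \<open>v / 2\<close> each.\<close>

lemma nn_integral_complex_normal_cmod_power2:
  assumes v: "0 < v"
  shows "(\<integral>\<^sup>+z. ennreal ((cmod z)\<^sup>2) \<partial>complex_normal v) = ennreal v"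
proof -
  define G where "G = density lborel (\<lambda>t. ennreal (normal_density 0 (sqrt (v / 2)) t))"
  have "prob_space G"
    unfolding G_def using v by (intro prob_space_normal_density) simp
  then interpret G: prob_space G .
  have [measurable_cong]: "sets G = sets borel"
    by (simp add: G_def)
  have sq: "(\<integral>\<^sup>+t. ennreal (t\<^sup>2) \<partial>G) = ennreal (v / 2)"
  proof -
    have "has_bochner_integral lborel (\<lambda>t. normal_density 0 (sqrt (v / 2)) t * t\<^sup>2) (v / 2)"
      using normal_moment_even[of "sqrt (v / 2)" 0 1] v by simp
    then have "(\<integral>\<^sup>+t. ennreal (normal_density 0 (sqrt (v / 2)) t * t\<^sup>2) \<partial>lborel) = ennreal (v / 2)"
      by (subst nn_integral_eq_integral) (auto simp: has_bochner_integral_iff simp del: eq_divide_eq_numeral1)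
    then show ?thesis
      unfolding G_def by (subst nn_integral_density) (auto simp: ennreal_mult')
  qed
  have "(\<integral>\<^sup>+b. ennreal (a\<^sup>2 + b\<^sup>2) \<partial>G) = ennreal (a\<^sup>2) + ennreal (v / 2)" for a
    by (simp add: nn_integral_add sq G.emeasure_space_1)
  then have "(\<integral>\<^sup>+a. \<integral>\<^sup>+b. ennreal (a\<^sup>2 + b\<^sup>2) \<partial>G \<partial>G) = ennreal (v / 2) + ennreal (v / 2)"
    by (simp add: nn_integral_add sq G.emeasure_space_1)
  also have "\<dots> = ennreal v"
    using v by (simp add: ennreal_plus[symmetric] del: ennreal_plus)
  finally show ?thesis
    using v by (subst nn_integral_complex_normal) (auto simp: G_def cmod_power2)
qed

text \<open>Induction over the coordinates. The bound can be iterated because its right side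
  integrates a square: integrating out one coordinate leaves a function whose square is controlled
  by the one-coordinate bound.\<close>

lemma nn_integral_PiM_complex_normal_shift_power2_le:
  fixes g :: "('i \<Rightarrow> complex) \<Rightarrow> ennreal"
  assumes v: "0 < v" and "finite I" and "g \<in> borel_measurable (Pi\<^sub>M I (\<lambda>_. borel))"
  shows "(\<integral>\<^sup>+n. g (\<lambda>i\<in>I. n i + s i) \<partial>Pi\<^sub>M I (\<lambda>_. complex_normal v))\<^sup>2
    \<le> ennreal (exp (2 * (\<Sum>i\<in>I. (cmod (s i))\<^sup>2) / v)) * (\<integral>\<^sup>+n. (g n)\<^sup>2 \<partial>Pi\<^sub>M I (\<lambda>_. complex_normal v))"
  using assms(2,3)
proof (induction I arbitrary: g rule: finite_induct)
  case empty
  then show ?case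
    by (simp add: PiM_empty nn_integral_count_space_finite restrict_def)
next
  case (insert j I)
  interpret C: prob_space "complex_normal v"
    by (rule prob_space_complex_normal[OF v])
  interpret product_sigma_finite "\<lambda>_::'i. complex_normal v"
    by standard
  let ?P = "\<lambda>I. Pi\<^sub>M I (\<lambda>_::'i. complex_normal v)"
  interpret P: sigma_finite_measure "?P I"
    using insert by (intro sigma_finite)
  have [measurable_cong]: "sets (?P J) = sets (Pi\<^sub>M J (\<lambda>_. borel))" for J
    by (intro sets_PiM_cong) auto
  note [measurable] = insert.prems
  have upd [measurable]: "(\<lambda>p. (fst p)(j := snd p)) \<in> Pi\<^sub>M I (\<lambda>_. borel) \<Otimes>\<^sub>M borel \<rightarrow>\<^sub>M Pi\<^sub>M (insert j I) (\<lambda>_. borel::complex measure)"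
    using measurable_add_dim[of j I "\<lambda>_. borel"] by (simp add: case_prod_beta')
  have gm: "(\<lambda>p. g ((fst p)(j := snd p + c))) \<in> borel_measurable (Pi\<^sub>M I (\<lambda>_. borel) \<Otimes>\<^sub>M complex_normal v)" for c
  proof -
    have "(\<lambda>p. (fst p, snd p + c)) \<in> Pi\<^sub>M I (\<lambda>_. borel) \<Otimes>\<^sub>M complex_normal v \<rightarrow>\<^sub>M Pi\<^sub>M I (\<lambda>_. borel) \<Otimes>\<^sub>M borel"
      by measurable
    from measurable_compose[OF measurable_compose[OF this upd] insert.prems] show ?thesis
      by simp
  qed
  have gsec: "(\<lambda>z. g (n(j := z))) \<in> borel_measurable borel" if "n \<in> space (?P I)" for n
  proof -
    have "(\<lambda>z. (n, z)) \<in> borel \<rightarrow>\<^sub>M Pi\<^sub>M I (\<lambda>_. borel) \<Otimes>\<^sub>M (borel :: complex measure)"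
      using that by (intro measurable_Pair1') (simp add: space_PiM)
    from measurable_compose[OF measurable_compose[OF this upd] insert.prems] show ?thesis
      by (simp only: fst_conv snd_conv)
  qed
  define h where "h n = (\<integral>\<^sup>+z. g (n(j := z + s j)) \<partial>complex_normal v)" for n
  have [measurable]: "h \<in> borel_measurable (Pi\<^sub>M I (\<lambda>_. borel))"
    unfolding h_def using C.borel_measurable_nn_integral_fst[OF gm] by simp
  have sq_meas: "(\<lambda>n. \<integral>\<^sup>+z. (g (n(j := z)))\<^sup>2 \<partial>complex_normal v) \<in> borel_measurable (?P I)"
    using C.borel_measurable_nn_integral_fst[OF borel_measurable_power_ennreal[OF gm[of 0], of 2]]
    by simp
  have shift_meas: "(\<lambda>n. g (\<lambda>i\<in>insert j I. n i + s i)) \<in> borel_measurable (?P (insert j I))"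
    by (rule measurable_compose[OF _ insert.prems]) measurable
  have "(\<integral>\<^sup>+n. g (\<lambda>i\<in>insert j I. n i + s i) \<partial>?P (insert j I))
      = (\<integral>\<^sup>+n. \<integral>\<^sup>+z. g (\<lambda>i\<in>insert j I. (n(j := z)) i + s i) \<partial>complex_normal v \<partial>?P I)"
    using insert.hyps shift_meas by (rule product_nn_integral_insert)
  also have "\<dots> = (\<integral>\<^sup>+n. h (\<lambda>i\<in>I. n i + s i) \<partial>?P I)"
  proof -
    have "(\<lambda>i\<in>insert j I. (n(j := z)) i + s i) = (\<lambda>i\<in>I. n i + s i)(j := z + s j)" for n z
      using insert.hyps by (auto simp: restrict_def)
    then show ?thesis
      by (simp add: h_def)
  qed
  finally have "(\<integral>\<^sup>+n. g (\<lambda>i\<in>insert j I. n i + s i) \<partial>?P (insert j I))\<^sup>2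
      \<le> ennreal (exp (2 * (\<Sum>i\<in>I. (cmod (s i))\<^sup>2) / v)) * (\<integral>\<^sup>+n. (h n)\<^sup>2 \<partial>?P I)"
    using insert.IH[of h] by (simp only: \<open>h \<in> _\<close> simp_thms)
  \<comment> \<open>The one-coordinate bound is used for each fixed value of the coordinates in
    \<open>I\<close>, which the induction hypothesis has already unshifted.\<close>
  also have "(\<integral>\<^sup>+n. (h n)\<^sup>2 \<partial>?P I)
      \<le> (\<integral>\<^sup>+n. ennreal (exp (2 * (cmod (s j))\<^sup>2 / v)) * (\<integral>\<^sup>+z. (g (n(j := z)))\<^sup>2 \<partial>complex_normal v) \<partial>?P I)"
    unfolding h_def
    by (intro nn_integral_mono nn_integral_complex_normal_shift_power2_le v gsec)
  also have "\<dots> = ennreal (exp (2 * (cmod (s j))\<^sup>2 / v)) * (\<integral>\<^sup>+n. (g n)\<^sup>2 \<partial>?P (insert j I))"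
    using insert.hyps nn_integral_cmult[OF sq_meas]
    by (subst product_nn_integral_insert) auto
  also have "ennreal (exp (2 * (\<Sum>i\<in>I. (cmod (s i))\<^sup>2) / v)) * \<dots>
      = ennreal (exp (2 * (\<Sum>i\<in>insert j I. (cmod (s i))\<^sup>2) / v)) * (\<integral>\<^sup>+n. (g n)\<^sup>2 \<partial>?P (insert j I))"
  proof -
    have "2 * (\<Sum>i\<in>I. (cmod (s i))\<^sup>2) / v + 2 * (cmod (s j))\<^sup>2 / v = 2 * (\<Sum>i\<in>insert j I. (cmod (s i))\<^sup>2) / v"
      using insert.hyps by (simp add: add_divide_distrib)
    then have "ennreal (exp (2 * (\<Sum>i\<in>I. (cmod (s i))\<^sup>2) / v)) * ennreal (exp (2 * (cmod (s j))\<^sup>2 / v))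
        = ennreal (exp (2 * (\<Sum>i\<in>insert j I. (cmod (s i))\<^sup>2) / v))"
      by (simp only: ennreal_mult'[OF exp_ge_zero, symmetric] exp_add[symmetric])
    then show ?thesis
      by (simp only: mult.assoc[symmetric])
  qed
  finally show ?case
    by (simp add: mult_left_mono)
qed

section \<open>Consequences for the noise, the decoder events and the measurement matrix\<close>

lemma gauss_spaces:
  assumes "0 < \<nu>"
  shows "prob_space (gauss_matrix N M)" "prob_space (gauss_noise \<nu> N)"
    "sets (gauss_matrix N M) = sets (\<Pi>\<^sub>M p\<in>{..<N} \<times> {..<M}. borel)"
    "sets (gauss_noise \<nu> N) = sets (\<Pi>\<^sub>M i\<in>{..<N}. borel)"
    "space (gauss_noise \<nu> N) = {..<N} \<rightarrow>\<^sub>E UNIV"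
  using assms unfolding gauss_matrix_def gauss_noise_def
  by (auto intro!: prob_space_PiM prob_space_complex_normal sets_PiM_cong simp: space_PiM)

text \<open>With \<open>p\<close> and \<open>q\<close> the probabilities of \<open>E\<close> with
  and without the shift, Cauchy-Schwarz gives \<open>p\<^sup>2 \<le> c * q\<close>. The parameter
  \<open>\<theta>\<close> trades the square root for a bound linear in \<open>q\<close>, which can
  then be summed over candidates and integrated over the matrix.\<close>

lemma measure_gauss_noise_shift_le:
  assumes nu: "0 < \<nu>" and th: "0 < \<theta>" and E: "E \<in> sets (gauss_noise \<nu> N)"
  shows "measure (gauss_noise \<nu> N) {n \<in> space (gauss_noise \<nu> N). (\<lambda>i\<in>{..<N}. n i + s i) \<in> E}
    \<le> \<theta> / 2 + exp (2 * (\<Sum>i<N. (cmod (s i))\<^sup>2) / \<nu>\<^sup>2) / (2 * \<theta>) * measure (gauss_noise \<nu> N) E"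
proof -
  let ?G = "gauss_noise \<nu> N"
  define c where "c = exp (2 * (\<Sum>i<N. (cmod (s i))\<^sup>2) / \<nu>\<^sup>2)"
  interpret prob_space ?G
    using gauss_spaces[OF nu] by simp
  have [measurable_cong]: "sets ?G = sets (\<Pi>\<^sub>M i\<in>{..<N}. borel)"
    using gauss_spaces[OF nu] by simp
  have [measurable]: "E \<in> sets (\<Pi>\<^sub>M i\<in>{..<N}. borel)"
    using E gauss_spaces(4)[OF nu] by simp
  have sh: "(\<lambda>n. \<lambda>i\<in>{..<N}. n i + s i) \<in> ?G \<rightarrow>\<^sub>M (\<Pi>\<^sub>M i\<in>{..<N}. borel)"
    by measurable
  define F where "F = {n \<in> space ?G. (\<lambda>i\<in>{..<N}. n i + s i) \<in> E}"
  have F: "F \<in> sets ?G"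
    using measurable_sets[OF sh, of E] by (simp add: F_def vimage_def Int_def conj_commute)
  have "(\<integral>\<^sup>+n. indicator E (\<lambda>i\<in>{..<N}. n i + s i) \<partial>?G) = (\<integral>\<^sup>+n. indicator F n \<partial>?G)"
    by (intro nn_integral_cong) (auto simp: F_def indicator_def)
  then have p: "(\<integral>\<^sup>+n. indicator E (\<lambda>i\<in>{..<N}. n i + s i) \<partial>?G) = ennreal (prob F)"
    using F by (simp add: emeasure_eq_measure)
  \<comment> \<open>An indicator is its own square, so the second moment is again a
    probability.\<close>
  have "(\<integral>\<^sup>+n. (indicator E n)\<^sup>2 \<partial>?G) = (\<integral>\<^sup>+n. indicator E n \<partial>?G)"
    by (intro nn_integral_cong) (auto simp: indicator_def)
  then have q: "(\<integral>\<^sup>+n. (indicator E n)\<^sup>2 \<partial>?G) = ennreal (prob E)"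
    using E by (simp add: emeasure_eq_measure)
  have "(\<integral>\<^sup>+n. indicator E (\<lambda>i\<in>{..<N}. n i + s i) \<partial>?G)\<^sup>2
      \<le> ennreal c * (\<integral>\<^sup>+n. (indicator E n)\<^sup>2 \<partial>?G)"
    unfolding c_def gauss_noise_def
    by (rule nn_integral_PiM_complex_normal_shift_power2_le) (use nu in auto)
  then have "ennreal ((prob F)\<^sup>2) \<le> ennreal (c * prob E)"
    unfolding p q by (simp add: ennreal_power ennreal_mult c_def)
  then have "(prob F)\<^sup>2 \<le> c * prob E"
    by (subst (asm) ennreal_le_iff) (auto simp: c_def)
  \<comment> \<open>The arithmetic-geometric mean inequality linearises the squared
    probability.\<close>
  moreover have "2 * prob F * \<theta> \<le> \<theta>\<^sup>2 + (prob F)\<^sup>2"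
    using sum_squares_bound[of "prob F" \<theta>] by simp
  ultimately have "2 * prob F * \<theta> \<le> \<theta>\<^sup>2 + c * prob E"
    by linarith
  then have "prob F \<le> \<theta> / 2 + c / (2 * \<theta>) * prob E"
    using th by (simp add: field_simps power2_eq_square)
  then show ?thesis
    by (simp add: F_def c_def)
qed

text \<open>Agreement of supports is a finite conjunction over coordinates. The transmitted
  \<open>x\<close> and the answered \<open>z\<close> are kept separate because the reference law
  transmits a vector different from every candidate.\<close>

lemma measurable_decoder_event:
  assumes "recovery_algorithm N M L R"
  shows "{p \<in> space ((\<Pi>\<^sub>M p\<in>{..<N} \<times> {..<M}. borel) \<Otimes>\<^sub>M (\<Pi>\<^sub>M i\<in>{..<N}. borel)).
      decoder M R (fst p) (observation N M (fst p) x (snd p)) = supp M z}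
    \<in> sets ((\<Pi>\<^sub>M p\<in>{..<N} \<times> {..<M}. borel) \<Otimes>\<^sub>M (\<Pi>\<^sub>M i\<in>{..<N}. borel))"
proof -
  let ?A = "\<Pi>\<^sub>M p\<in>{..<N} \<times> {..<M}. borel :: complex measure"
  let ?N = "\<Pi>\<^sub>M i\<in>{..<N}. borel :: complex measure"
  have R_meas: "(\<lambda>(A, y). R A y) \<in> ?A \<Otimes>\<^sub>M ?N \<rightarrow>\<^sub>M (\<Pi>\<^sub>M j\<in>{..<M}. borel)"
    using assms by (simp add: recovery_algorithm_def)
  have "(\<lambda>p. observation N M (fst p) x (snd p)) \<in> ?A \<Otimes>\<^sub>M ?N \<rightarrow>\<^sub>M ?N"
    unfolding observation_def by measurable
  from measurable_compose[OF measurable_Pair[OF measurable_fst this] R_meas]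
  have "(\<lambda>p. R (fst p) (observation N M (fst p) x (snd p))) \<in> ?A \<Otimes>\<^sub>M ?N \<rightarrow>\<^sub>M (\<Pi>\<^sub>M j\<in>{..<M}. borel)"
    by simp
  note est = measurable_compose[OF this measurable_component_singleton]
  have "{p \<in> space (?A \<Otimes>\<^sub>M ?N). decoder M R (fst p) (observation N M (fst p) x (snd p)) = supp M z}
      = {p \<in> space (?A \<Otimes>\<^sub>M ?N). \<forall>j\<in>{..<M}.
          (R (fst p) (observation N M (fst p) x (snd p)) j = 0) = (z j = 0)}"
    by (auto simp: decoder_def supp_def)
  also have "\<dots> \<in> sets (?A \<Otimes>\<^sub>M ?N)"
    using est by measurable
  finally show ?thesis .
qed

lemma has_bochner_integral_gauss_matrix_cmod_power2:
  assumes "p \<in> {..<N} \<times> {..<M}"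
  shows "has_bochner_integral (gauss_matrix N M) (\<lambda>A. (cmod (A p))\<^sup>2) 1"
proof -
  have C: "prob_space (complex_normal 1)"
    by (rule prob_space_complex_normal) simp
  have comp: "(\<lambda>A. A p) \<in> gauss_matrix N M \<rightarrow>\<^sub>M complex_normal 1"
    unfolding gauss_matrix_def using assms by (rule measurable_component_singleton)
  have distr: "distr (gauss_matrix N M) (complex_normal 1) (\<lambda>A. A p) = complex_normal 1"
    unfolding gauss_matrix_def using assms C by (subst distr_PiM_component) auto
  have "(\<integral>\<^sup>+A. ennreal ((cmod (A p))\<^sup>2) \<partial>gauss_matrix N M)
      = (\<integral>\<^sup>+z. ennreal ((cmod z)\<^sup>2) \<partial>distr (gauss_matrix N M) (complex_normal 1) (\<lambda>A. A p))"
    using comp by (subst nn_integral_distr) auto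
  also have "\<dots> = ennreal 1"
    unfolding distr by (rule nn_integral_complex_normal_cmod_power2) simp
  finally show ?thesis
    using measurable_compose[OF comp, of "\<lambda>z. (cmod z)\<^sup>2" borel]
    by (intro has_bochner_integral_nn_integral) auto
qed

section \<open>Total success probability over the candidate positions\<close>

text \<open>Every candidate \<open>x(k := v)\<close> is compared with the common reference
  \<open>x\<close>, for which the events of answering different candidates are disjoint. The three
  terms account for columns of large energy (Markov's inequality at level \<open>w\<close>), the
  linearisation by \<open>\<theta>\<close>, and the total reference probability, which is at most
  1.\<close>

lemma sum_success_probability_le:
  assumes R: "recovery_algorithm N M L R" and nu: "0 < \<nu>" and th: "0 < \<theta>" and w: "0 < w"
    and T: "T \<subseteq> {..<M}" and x: "\<And>k. k \<in> T \<Longrightarrow> x k = 0" and v: "v \<noteq> 0"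
  shows "(\<Sum>k\<in>T. 1 - p_err \<nu> N M (decoder M R) (x(k := v)))
    \<le> real (card T) * (real N * (cmod v)\<^sup>2 / (\<nu>\<^sup>2 * w) + \<theta> / 2) + exp (2 * w) / (2 * \<theta>)"
proof -
  let ?D = "decoder M R" and ?A = "gauss_matrix N M" and ?G = "gauss_noise \<nu> N"
  let ?BA = "\<Pi>\<^sub>M p\<in>{..<N} \<times> {..<M}. borel :: complex measure"
  let ?BN = "\<Pi>\<^sub>M i\<in>{..<N}. borel :: complex measure"
  note G = gauss_spaces[OF nu]
  interpret A: prob_space ?A by (rule G)
  interpret G: prob_space ?G by (rule G)
  have finT: "finite T"
    using T finite_subset by blast
  have sets_eq: "sets (?A \<Otimes>\<^sub>M ?G) = sets (?BA \<Otimes>\<^sub>M ?BN)"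
    by (intro sets_pair_measure_cong G)
  have space_eq: "space (?A \<Otimes>\<^sub>M ?G) = space (?BA \<Otimes>\<^sub>M ?BN)"
    by (rule sets_eq_imp_space_eq[OF sets_eq])
  define S where "S k = supp M (x(k := v))" for k
  \<comment> \<open>The noise for which the answer is candidate \<open>k\<close> although
    \<open>z\<close> was transmitted; below, \<open>z\<close> is either the candidate itself or the
    reference \<open>x\<close>.\<close>
  define Ev where "Ev z k A = {n \<in> space ?G. ?D A (observation N M A z n) = S k}" for z k A
  have event: "{p \<in> space (?A \<Otimes>\<^sub>M ?G). ?D (fst p) (observation N M (fst p) z (snd p)) = S k} \<in> sets (?A \<Otimes>\<^sub>M ?G)" for z k
    using measurable_decoder_event[OF R, of z "x(k := v)"] unfolding S_def sets_eq space_eq .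
  have Ev_eq: "Pair A -` {p \<in> space (?A \<Otimes>\<^sub>M ?G). ?D (fst p) (observation N M (fst p) z (snd p)) = S k} = Ev z k A"
    if "A \<in> space ?A" for z k A
    using that by (auto simp: Ev_def space_pair_measure)
  have Ev_sets: "Ev z k A \<in> sets ?G" if "A \<in> space ?A" for z k A
    using sets_Pair1[OF event, of A z k] Ev_eq[OF that, of z k] by simp
  have int: "integrable ?A (\<lambda>A. G.prob (Ev z k A))" for z k
  proof (rule A.integrable_const_bound[where B = 1])
    have "(\<lambda>A. G.prob (Pair A -` {p \<in> space (?A \<Otimes>\<^sub>M ?G). ?D (fst p) (observation N M (fst p) z (snd p)) = S k}))
        \<in> borel_measurable ?A"
      unfolding measure_def using G.measurable_emeasure_Pair[OF event] by measurable
    then show "(\<lambda>A. G.prob (Ev z k A)) \<in> borel_measurable ?A"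
      by (rule measurable_cong[THEN iffD1, rotated]) (simp only: Ev_eq)
  qed simp
  have p_err: "1 - p_err \<nu> N M ?D (x(k := v)) = (\<integral>A. G.prob (Ev (x(k := v)) k A) \<partial>?A)" for k
  proof -
    have "p_err_given \<nu> N M ?D (x(k := v)) A = 1 - G.prob (Ev (x(k := v)) k A)" if "A \<in> space ?A" for A
    proof -
      have "{n \<in> space ?G. ?D A (observation N M A (x(k := v)) n) \<noteq> supp M (x(k := v))}
          = space ?G - Ev (x(k := v)) k A"
        by (auto simp: Ev_def S_def)
      then show ?thesis
        unfolding p_err_given_def using G.prob_compl[OF Ev_sets[OF that]] by simp
    qed
    then have "p_err \<nu> N M ?D (x(k := v)) = (\<integral>A. 1 - G.prob (Ev (x(k := v)) k A) \<partial>?A)"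
      unfolding p_err_def by (intro Bochner_Integration.integral_cong) auto
    also have "\<dots> = 1 - (\<integral>A. G.prob (Ev (x(k := v)) k A) \<partial>?A)"
      using int by (simp add: A.prob_space)
    finally show ?thesis
      by simp
  qed
  \<comment> \<open>Half the exponent of the change of measure: the energy of column
    \<open>k\<close> scaled by \<open>v\<close>, relative to the noise variance.\<close>
  define W where "W k A = (\<Sum>i<N. (cmod (v * A (i, k)))\<^sup>2) / \<nu>\<^sup>2" for k :: nat and A
  have W: "has_bochner_integral ?A (W k) (real N * (cmod v)\<^sup>2 / \<nu>\<^sup>2)" if "k \<in> T" for k
  proof -
    have "has_bochner_integral ?A (\<lambda>A. (\<Sum>i<N. (cmod v)\<^sup>2 * (cmod (A (i, k)))\<^sup>2) / \<nu>\<^sup>2)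
        ((\<Sum>i<N. (cmod v)\<^sup>2 * 1) / \<nu>\<^sup>2)"
      using that T
      by (intro has_bochner_integral_divide has_bochner_integral_sum has_bochner_integral_mult_right
          has_bochner_integral_gauss_matrix_cmod_power2) auto
    then show ?thesis
      by (simp add: W_def[abs_def] norm_mult power_mult_distrib)
  qed
  define c where "c = exp (2 * w) / (2 * \<theta>)"
  have c: "0 \<le> c"
    using th by (simp add: c_def)
  \<comment> \<open>Markov's inequality in pointwise form: if the energy exceeds \<open>w\<close>,
    the first term alone is at least 1; otherwise the exponential factor is at most its value at
    \<open>w\<close>.\<close>
  have bound: "G.prob (Ev (x(k := v)) k A) \<le> W k A / w + \<theta> / 2 + c * G.prob (Ev x k A)"
    if "k \<in> T" "A \<in> space ?A" for k A
  proof (cases "W k A \<le> w")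
    case True
    let ?sh = "\<lambda>n. \<lambda>i\<in>{..<N}. n i + v * A (i, k)"
    \<comment> \<open>Since \<open>x k = 0\<close>, inserting \<open>v\<close> at \<open>k\<close>
      just adds \<open>v\<close> times column \<open>k\<close>, which can be counted as part of the
      noise.\<close>
    have "(\<Sum>j<M. A (i, j) * (x(k := v)) j) = (\<Sum>j<M. A (i, j) * x j) + v * A (i, k)" for i
    proof -
      have "(\<Sum>j<M. A (i, j) * (x(k := v)) j) = (\<Sum>j<M. A (i, j) * x j + (if j = k then v * A (i, k) else 0))"
        using x[OF that(1)] by (intro sum.cong) auto
      then show ?thesis
        using that T by (auto simp: sum.distrib)
    qed
    then have "observation N M A (x(k := v)) n = observation N M A x (?sh n)" for n
      unfolding observation_def by (intro restrict_ext) (simp add: add_ac)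
    then have "Ev (x(k := v)) k A = {n \<in> space ?G. ?sh n \<in> Ev x k A}"
      by (auto simp: Ev_def G(5))
    then have "G.prob (Ev (x(k := v)) k A) \<le> \<theta> / 2 + exp (2 * W k A) / (2 * \<theta>) * G.prob (Ev x k A)"
      using measure_gauss_noise_shift_le[OF nu th Ev_sets[OF that(2)], of "\<lambda>i. v * A (i, k)" x k]
      by (simp add: W_def)
    also have "exp (2 * W k A) / (2 * \<theta>) \<le> c"
      unfolding c_def using True th by (intro divide_right_mono) auto
    finally have "G.prob (Ev (x(k := v)) k A) \<le> \<theta> / 2 + c * G.prob (Ev x k A)"
      by (simp add: mult_right_mono)
    moreover have "0 \<le> W k A / w"
      using w by (simp add: W_def sum_nonneg)
    ultimately show ?thesis
      by linarith
  next
    case False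
    then have "1 \<le> W k A / w"
      using w by simp
    moreover have "G.prob (Ev (x(k := v)) k A) \<le> 1"
      by simp
    moreover have "0 \<le> \<theta> / 2 + c * G.prob (Ev x k A)"
      using th c by simp
    ultimately show ?thesis
      by linarith
  qed
  \<comment> \<open>As \<open>x\<close> vanishes on \<open>T\<close>, the set \<open>S k\<close>
    meets \<open>T\<close> only in \<open>k\<close>, so its position can be read off.\<close>
  have S_inj: "inj_on S T"
  proof (rule inj_onI)
    fix k l assume kl: "k \<in> T" "l \<in> T" "S k = S l"
    have "k \<in> S k"
      using kl(1) T v by (auto simp: S_def supp_def)
    then have "k \<in> S l"
      by (simp only: kl(3))
    then show "k = l"
      using x[OF kl(1)] by (auto simp: S_def supp_def split: if_splits)
  qed
  have disj: "(\<Sum>k\<in>T. G.prob (Ev x k A)) \<le> 1" if "A \<in> space ?A" for A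
  proof -
    have "disjoint_family_on (\<lambda>k. Ev x k A) T"
      using S_inj by (auto simp: disjoint_family_on_def Ev_def inj_on_def)
    then have "(\<Sum>k\<in>T. G.prob (Ev x k A)) = G.prob (\<Union>k\<in>T. Ev x k A)"
      using Ev_sets[OF that] finT by (intro G.finite_measure_finite_Union[symmetric]) auto
    then show ?thesis
      by simp
  qed
  have "(\<Sum>k\<in>T. 1 - p_err \<nu> N M ?D (x(k := v)))
      \<le> (\<Sum>k\<in>T. real N * (cmod v)\<^sup>2 / \<nu>\<^sup>2 / w + \<theta> / 2 + c * (\<integral>A. G.prob (Ev x k A) \<partial>?A))"
  proof (rule sum_mono)
    fix k assume k: "k \<in> T"
    have Wi: "integrable ?A (W k)" "(\<integral>A. W k A \<partial>?A) = real N * (cmod v)\<^sup>2 / \<nu>\<^sup>2"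
      using W[OF k] by (auto simp: has_bochner_integral_iff)
    have "(\<integral>A. G.prob (Ev (x(k := v)) k A) \<partial>?A)
        \<le> (\<integral>A. W k A / w + \<theta> / 2 + c * G.prob (Ev x k A) \<partial>?A)"
      using Wi int bound[OF k] by (intro integral_mono) auto
    also have "\<dots> = real N * (cmod v)\<^sup>2 / \<nu>\<^sup>2 / w + \<theta> / 2 + c * (\<integral>A. G.prob (Ev x k A) \<partial>?A)"
      using Wi int by (simp add: A.prob_space)
    finally show "1 - p_err \<nu> N M ?D (x(k := v))
        \<le> real N * (cmod v)\<^sup>2 / \<nu>\<^sup>2 / w + \<theta> / 2 + c * (\<integral>A. G.prob (Ev x k A) \<partial>?A)"
      by (simp add: p_err)
  qed
  also have "\<dots> = real (card T) * (real N * (cmod v)\<^sup>2 / (\<nu>\<^sup>2 * w) + \<theta> / 2)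
      + c * (\<integral>A. (\<Sum>k\<in>T. G.prob (Ev x k A)) \<partial>?A)"
    using int by (simp add: sum.distrib sum_distrib_left distrib_left Bochner_Integration.integral_sum)
  \<comment> \<open>The disjointness bound holds for each matrix, so averaging over the matrix keeps
    the reference sum at most 1, however many candidates there are.\<close>
  also have "\<dots> \<le> real (card T) * (real N * (cmod v)\<^sup>2 / (\<nu>\<^sup>2 * w) + \<theta> / 2) + c"
  proof -
    have "(\<integral>A. (\<Sum>k\<in>T. G.prob (Ev x k A)) \<partial>?A) \<le> (\<integral>A. 1 \<partial>?A)"
      using int disj by (intro integral_mono) auto
    then have "c * (\<integral>A. (\<Sum>k\<in>T. G.prob (Ev x k A)) \<partial>?A) \<le> c"
      using c by (simp add: A.prob_space mult_left_le)
    then show ?thesis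
      by simp
  qed
  finally show ?thesis
    by (simp add: c_def)
qed

section \<open>A bad relabelling for each fixed dimension\<close>

text \<open>If all relabellings had error below \<open>1 / 4\<close>, the candidates obtained by
  moving one smallest nonzero entry would have average success above \<open>3 / 4\<close>. The
  hypotheses make each of the three terms of the averaged bound at most
  \<open>1 / 4\<close>.\<close>

lemma exists_relabelling_large_p_err:
  assumes R: "recovery_algorithm N M L\<^sub>0 R" and nu: "0 < \<nu>"
    and L: "l0norm M x = L" "0 < L" and large: "16 \<le> M - L"
    and bound: "real N * total_power M x / (real L * \<nu>\<^sup>2) \<le> ln (real (M - L)) / 16"
  shows "\<exists>\<sigma>. \<sigma> permutes {..<M} \<and> 1 / 4 \<le> p_err \<nu> N M (decoder M R) (x \<circ> \<sigma>)"
proof (rule ccontr)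
  assume contra: "\<nexists>\<sigma>. \<sigma> permutes {..<M} \<and> 1 / 4 \<le> p_err \<nu> N M (decoder M R) (x \<circ> \<sigma>)"
  have S: "finite (supp M x)" "supp M x \<noteq> {}" "supp M x \<subseteq> {..<M}" "card (supp M x) = L"
    using L by (auto simp: l0norm_def supp_def card_gt_0_iff)
  obtain i\<^sub>0 where i0: "i\<^sub>0 \<in> supp M x" "\<And>j. j \<in> supp M x \<Longrightarrow> (cmod (x i\<^sub>0))\<^sup>2 \<le> (cmod (x j))\<^sup>2"
    using arg_min_if_finite(1)[OF S(1,2), of "\<lambda>j. (cmod (x j))\<^sup>2"]
      arg_min_least[OF S(1,2), of _ "\<lambda>j. (cmod (x j))\<^sup>2"] by blast
  define v where "v = x i\<^sub>0"
  have v: "v \<noteq> 0" and i0M: "i\<^sub>0 < M"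
    using i0(1) by (auto simp: v_def supp_def)
  have "real L * (cmod v)\<^sup>2 = (\<Sum>j\<in>supp M x. (cmod v)\<^sup>2)"
    by (simp add: S)
  also have "\<dots> \<le> (\<Sum>j\<in>supp M x. (cmod (x j))\<^sup>2)"
    using i0(2) by (intro sum_mono) (simp add: v_def)
  also have "\<dots> \<le> total_power M x"
    unfolding total_power_def using S by (intro sum_mono2) auto
  finally have "(cmod v)\<^sup>2 \<le> total_power M x / real L"
    using L by (simp add: field_simps)
  then have "real N * (cmod v)\<^sup>2 / \<nu>\<^sup>2 \<le> real N * (total_power M x / real L) / \<nu>\<^sup>2"
    using nu by (intro divide_right_mono mult_left_mono) auto
  then have Nv: "real N * (cmod v)\<^sup>2 / \<nu>\<^sup>2 \<le> ln (real (M - L)) / 16"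
    using bound by (simp only: times_divide_eq_right divide_divide_eq_left order_trans)
  \<comment> \<open>The original position of \<open>v\<close> is a candidate as well, hence
    \<open>M - L + 1\<close> candidates.\<close>
  define T where "T = insert i\<^sub>0 ({..<M} - supp M x)"
  have T: "T \<subseteq> {..<M}" "finite T" "T \<noteq> {}"
    using i0M by (auto simp: T_def)
  have K: "card T = Suc (M - L)"
    using S i0(1) by (simp add: T_def card_Diff_subset)
  \<comment> \<open>This level makes \<open>exp (2 * w)\<close> the square root of the number of
    candidates, which is at most a quarter of that number once it is 16 or more. The
    \<open>1 / 16\<close> in the hypothesis then bounds the mean energy by
    \<open>w / 4\<close>.\<close>
  define w where "w = ln (real (card T)) / 4"
  have w: "0 < w"
    using K large by (simp add: w_def)
  have "ln (real (M - L)) \<le> ln (real (card T))"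
    using K large by simp
  then have "real N * (cmod v)\<^sup>2 / \<nu>\<^sup>2 \<le> w / 4"
    using Nv by (simp add: w_def)
  then have Nw: "real N * (cmod v)\<^sup>2 / (\<nu>\<^sup>2 * w) \<le> 1 / 4"
    using w nu by (simp add: field_simps)
  have "exp (2 * w) = sqrt (real (card T))"
    using K by (simp add: w_def ln_sqrt[symmetric])
  also have "\<dots> \<le> real (card T) / 4"
  proof (rule real_le_lsqrt)
    have "16 * real (card T) \<le> real (card T) * real (card T)"
      using K large by (intro mult_right_mono) auto
    then show "real (card T) \<le> (real (card T) / 4)\<^sup>2"
      by (simp add: power2_eq_square)
  qed auto
  finally have ew: "exp (2 * w) \<le> real (card T) / 4" .
  \<comment> \<open>Swapping \<open>i\<^sub>0\<close> with a zero position moves only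
    \<open>v\<close>, so every candidate is a relabelling of \<open>x\<close>; for
    \<open>k = i\<^sub>0\<close> it is \<open>x\<close> itself.\<close>
  have x_swap: "x \<circ> Transposition.transpose i\<^sub>0 k = (x(i\<^sub>0 := 0))(k := v)" if "k \<in> T" for k
    using that by (auto simp: fun_eq_iff T_def supp_def v_def Transposition.transpose_def)
  have "3 / 4 * real (card T) = (\<Sum>k\<in>T. 3 / 4)"
    by simp
  also have "\<dots> < (\<Sum>k\<in>T. 1 - p_err \<nu> N M (decoder M R) ((x(i\<^sub>0 := 0))(k := v)))"
  proof (rule sum_strict_mono[OF T(2,3)])
    fix k assume k: "k \<in> T"
    then have "Transposition.transpose i\<^sub>0 k permutes {..<M}"
      using T i0M by (intro permutes_swap_id) auto
    then show "3 / 4 < 1 - p_err \<nu> N M (decoder M R) ((x(i\<^sub>0 := 0))(k := v))"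
      using contra x_swap[OF k] by force
  qed
  \<comment> \<open>The choice \<open>\<theta> = 1 / 2\<close> makes the linearisation term
    \<open>1 / 4\<close> and the last term exactly \<open>exp (2 * w)\<close>.\<close>
  also have "\<dots> \<le> real (card T) * (real N * (cmod v)\<^sup>2 / (\<nu>\<^sup>2 * w) + (1 / 2) / 2) + exp (2 * w) / (2 * (1 / 2))"
    using T by (intro sum_success_probability_le[OF R nu _ w _ _ v]) (auto simp: T_def supp_def)
  also have "\<dots> \<le> real (card T) * (1 / 4 + (1 / 2) / 2) + (real (card T) / 4) / (2 * (1 / 2))"
    using Nw ew by (intro add_mono mult_left_mono divide_right_mono) auto
  finally show False
    by simp
qed

section \<open>From the asymptotic hypotheses to the fixed-dimension bound\<close>

theorem theoremV2:
  shows "\<exists>C\<^sub>2 :: real \<Rightarrow> real \<Rightarrow> real.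
    (\<forall>P \<nu>. 0 < P \<longrightarrow> 0 < \<nu> \<longrightarrow> 0 < C\<^sub>2 P \<nu>) \<and>
    (\<forall>(\<nu> :: real) (N :: nat \<Rightarrow> nat) (x :: nat \<Rightarrow> nat \<Rightarrow> complex) (L :: nat \<Rightarrow> nat) (P :: nat \<Rightarrow> real).
       0 < \<nu> \<longrightarrow>
       (\<forall>M. l0norm M (x M) = L M) \<longrightarrow>
       (\<forall>M. total_power M (x M) = P M) \<longrightarrow>
       (\<forall>\<^sub>F M in sequentially. 0 < P M) \<longrightarrow>
       (\<lambda>M. real (L M)) \<in> o(\<lambda>M. real M) \<longrightarrow>
       eventually_dominates
         (\<lambda>M. C\<^sub>2 (P M) \<nu> * (real (L M) * ln (real (M - L M)) / ln (P M)))
         (\<lambda>M. real (N M)) \<longrightarrow>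
       recovery_not_possible \<nu> N x)"
proof -
  define C\<^sub>2 :: "real \<Rightarrow> real \<Rightarrow> real"
    where "C\<^sub>2 P \<nu> = (if 1 < P then \<nu>\<^sup>2 * ln P / (16 * P) else 1)" for P \<nu>
  \<comment> \<open>For \<open>P > 1\<close> the \<open>ln P\<close> of the hypothesis cancels.  For \<open>0 < P \<le> 1\<close> the hypothesis bounds \<open>N\<close> by a
    nonpositive number (\<open>0\<close> by division by zero if \<open>P = 1\<close>), so the value there is irrelevant.\<close>
  have pos: "0 < C\<^sub>2 P \<nu>" if "0 < P" "0 < \<nu>" for P \<nu>
    using that by (simp add: C\<^sub>2_def)
  have "recovery_not_possible \<nu> N x"
    if nu: "0 < \<nu>" and L: "\<forall>M. l0norm M (x M) = L M" and P: "\<forall>M. total_power M (x M) = P M"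
      and P_pos: "\<forall>\<^sub>F M in sequentially. 0 < P M" and oL: "(\<lambda>M. real (L M)) \<in> o(\<lambda>M. real M)"
      and dom: "eventually_dominates
         (\<lambda>M. C\<^sub>2 (P M) \<nu> * (real (L M) * ln (real (M - L M)) / ln (P M))) (\<lambda>M. real (N M))"
    for \<nu> N x L P
    unfolding recovery_not_possible_def
  proof (intro allI impI exI[of _ "1 / 4"] conjI)
    fix R assume R: "\<forall>M. recovery_algorithm (N M) M (l0norm M (x M)) (R M)"
    \<comment> \<open>With \<open>L \<le> M / 2\<close> and \<open>M \<ge> 32\<close>, at least 16
      coordinates lie outside the support.\<close>
    have "\<forall>\<^sub>F M in sequentially. norm (real (L M)) \<le> 1 / 2 * norm (real M)"
      using landau_o.smallD[OF oL, of "1 / 2"] by simp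
    moreover have "\<forall>\<^sub>F M in sequentially. 32 \<le> M"
      by (rule eventually_ge_at_top)
    \<comment> \<open>The disjunct \<open>N M = 0\<close> covers the case \<open>f = g = 0\<close>
      of the domination relation, where there is no strict inequality.\<close>
    moreover have "\<forall>\<^sub>F M in sequentially. N M = 0 \<or>
        real (N M) < C\<^sub>2 (P M) \<nu> * (real (L M) * ln (real (M - L M)) / ln (P M))"
      using dom unfolding eventually_dominates_def
    proof (elim disjE conjE exE)
      fix m\<^sub>0
      assume nonneg: "\<forall>m. 0 \<le> C\<^sub>2 (P m) \<nu> * (real (L m) * ln (real (m - L m)) / ln (P m))"
        and less: "\<forall>m>m\<^sub>0. ereal (C\<^sub>2 (P m) \<nu> * (real (L m) * ln (real (m - L m)) / ln (P m)))
          / ereal (real (N m)) > 1"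
      show ?thesis
        using eventually_gt_at_top[of m\<^sub>0]
      proof eventually_elim
        case (elim m)
        then show ?case
          using less[rule_format, of m] nonneg[rule_format, of m]
          by (subst (asm) ereal_quotient_gt_1_iff) auto
      qed
    qed auto
    ultimately show "\<forall>\<^sub>F M in sequentially.
        \<exists>\<sigma>. \<sigma> permutes {..<M} \<and> 1 / 4 \<le> p_err \<nu> (N M) M (decoder M (R M)) (x M \<circ> \<sigma>)"
      using P_pos
    proof eventually_elim
      case (elim M)
      have large: "16 \<le> M - L M"
        using elim(1,2) by (simp add: field_simps)
      then have ln_pos: "0 < ln (real (M - L M))"
        by simp
      \<comment> \<open>An empty support would force zero power, against the eventual positivity of
        \<open>P\<close>.\<close>
      have L_pos: "0 < L M"
      proof (rule ccontr)
        assume "\<not> 0 < L M"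
        then have "supp M (x M) = {}"
          using L[rule_format, of M] by (simp add: l0norm_def supp_def)
        then have "total_power M (x M) = 0"
          by (auto simp: total_power_def supp_def intro!: sum.neutral)
        then show False
          using P elim(4) by simp
      qed
      have "real (N M) * P M / (real (L M) * \<nu>\<^sup>2) \<le> ln (real (M - L M)) / 16"
        using elim(3)
      proof
        assume less: "real (N M) < C\<^sub>2 (P M) \<nu> * (real (L M) * ln (real (M - L M)) / ln (P M))"
        show ?thesis
        proof (cases "1 < P M")
          case True
          then have "real (N M) < \<nu>\<^sup>2 * (real (L M) * ln (real (M - L M))) / (16 * P M)"
            using less by (simp add: C\<^sub>2_def)
          then show ?thesis
            using True nu L_pos by (simp add: field_simps)
        next
          case False
          then have "real (L M) * ln (real (M - L M)) / ln (P M) \<le> 0"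
            using elim(4) ln_pos by (intro divide_nonneg_nonpos) auto
          then show ?thesis
            using less False by (simp add: C\<^sub>2_def)
        qed
      qed (use ln_pos in simp)
      then show ?case
        using R L P nu large L_pos
        by (intro exists_relabelling_large_p_err[where L = "L M" and L\<^sub>0 = "L M"]) auto
    qed
  qed simp
  with pos show ?thesis
    by (intro exI[of _ C\<^sub>2]) blast
qed

end
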